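(* There is a universal constant $c$ such that the following holds. Consider the source model in which all source symbols have length $L$, in the asymptotic regime described in the context, and modified fixed-length deduplication (mFLD) with first-stage parsing length $D=L$ and chunk length $\ell=\ell(B)$. If $\ell=o(\log B)$ or $\ell=\omega(\log B)$, then for any edit probability $\delta\in(0,\frac12)$ the compression ratio satisfies $\frac{\mathbb{E}[|\boldsymbol{s}|]}{\mathbb{E}[\mathcal{L}_{mF}(\boldsymbol{s})]}\le c$ for all sufficiently large $B$.
   Context: All logarithms are base 2. Source model (equal symbol lengths). Parameters: positive integers $A,B,L$ and an edit probability $\delta$. Source symbols $X_1,\dots,X_A$ are drawn independently and uniformly from $\{0,1\}^L$ (with replacement). Then, independently for $b=1,\dots,B$, an index $J_b$ is drawn uniformly from $\{1,\dots,A\}$ and the source block $Y_b$ is obtained from $X_{J_b}$ by a $\delta$-edit, i.e. by flipping each bit independently with probability $\delta$. The data stream is $\boldsymbol{s}=Y_1Y_2\cdots Y_B$. Asymptotic regime. $B\to\infty$; $A$ and $L$ are functions of $B$ tending to infinity with $A\le B^{1-k_2}$ for a fixed $0<k_2<1$ and $L=\Theta(B^{k_1})$ for a fixed $k_1>0$; $\delta\in(0,\frac12)$ is constant. Dictionary encoding of a parsed string. Given a parsing of $\boldsymbol{s}$ into consecutive chunks, the encoding starts with a prefix-free (Elias gamma) encoding of $|\boldsymbol{s}|$. Chunks are then processed in order, starting with an empty dictionary. A chunk different from all previous chunks is encoded as the bit 1 followed by the chunk itself, and is entered into the dictionary. A chunk equal to an earlier one is encoded as the bit 0 followed by a pointer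 (index) to its dictionary entry; if the current dictionary has size $t$, the pointer takes $\lceil\log t\rceil$ bits. Modified fixed-length deduplication (mFLD) with first-stage parsing length $D$ and chunk length $\ell\le D$: $\boldsymbol{s}$ is parsed into consecutive segments of length $D$ (the last one possibly shorter), and each segment is parsed into consecutive chunks of length $\ell$ (the last chunk of a segment possibly shorter). The dictionary encoding is applied to the resulting chunks. $\mathcal{L}_{mF}(\boldsymbol{s})$ is the number of bits used to encode $\boldsymbol{s}$. *)

theory Defs
  imports
    "HOL-Probability.Probability"
    "HOL-Library.Landau_Symbols"
    "HOL-Library.Log_Nat"
begin

definition edit_pmf :: "real \<Rightarrow> bool list \<Rightarrow> bool list pmf" where
  "edit_pmf \<delta> x =
     map_pmf (\<lambda>flips. map2 (\<noteq>) x flips) (replicate_pmf (length x) (bernoulli_pmf \<delta>))"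

text \<open>Symbols are indexed from 0; the intended parameters satisfy \<open>A > 0\<close>.\<close>

definition source_pmf :: "nat \<Rightarrow> nat \<Rightarrow> nat \<Rightarrow> real \<Rightarrow> bool list pmf" where
  "source_pmf A B L \<delta> = do {
     X \<leftarrow> replicate_pmf A (pmf_of_set {x. length x = L});
     Y \<leftarrow> replicate_pmf B (do {
       j \<leftarrow> pmf_of_set {..<A};
       edit_pmf \<delta> (X ! j)
     });
     return_pmf (concat Y)
   }"

text \<open>The \<open>w\<close> lowest bits of \<open>n\<close>, most significant bit first.\<close>

definition to_bits :: "nat \<Rightarrow> nat \<Rightarrow> bool list" where
  "to_bits w n = map (bit n) (rev [0..<w])"

text \<open>For \<open>n > 0\<close>, \<open>floorlog 2 n\<close> is \<open>\<lfloor>log 2 n\<rfloor> + 1\<close>, the length of the binary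
  expansion of \<open>n\<close>.\<close>

definition elias_gamma :: "nat \<Rightarrow> bool list" where
  "elias_gamma n = replicate (floorlog 2 n - 1) False @ to_bits (floorlog 2 n) n"

lemma length_to_bits [simp]: "length (to_bits w n) = w"
  by (simp add: to_bits_def)

lemma length_elias_gamma:
  assumes "n > 0"
  shows "length (elias_gamma n) = 2 * nat \<lfloor>log 2 (real n)\<rfloor> + 1"
  using assms by (simp add: elias_gamma_def floorlog_def nat_add_distrib)

text \<open>For \<open>n = 0\<close> the whole string is a single chunk; only \<open>n > 0\<close> is relevant.\<close>

function chunks_of :: "nat \<Rightarrow> 'a list \<Rightarrow> 'a list list" where
  "chunks_of n xs =
     (if xs = [] then []
      else if n = 0 then [xs]
      else take n xs # chunks_of n (drop n xs))"
  by auto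
termination
  by (relation "Wellfounded.measure (length \<circ> snd)") auto

declare chunks_of.simps [simp del]

lemma concat_chunks_of [simp]: "concat (chunks_of n xs) = xs"
  by (induction n xs rule: chunks_of.induct) (subst chunks_of.simps, auto)

text \<open>The dictionary is the list of its entries in order of insertion, and a pointer is the
  0-based position of the entry. For a nonempty dictionary of size \<open>t\<close>,
  \<open>ceillog2 t = \<lceil>log 2 t\<rceil>\<close>.\<close>

definition pointer :: "'a list \<Rightarrow> 'a \<Rightarrow> bool list" where
  "pointer dict c = to_bits (ceillog2 (length dict)) (length (takeWhile (\<lambda>d. d \<noteq> c) dict))"

fun encode_chunks :: "bool list list \<Rightarrow> bool list list \<Rightarrow> bool list" where
  "encode_chunks dict [] = []"
| "encode_chunks dict (c # cs) =
     (if c \<in> set dict then False # pointer dict c @ encode_chunks dict cs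
      else True # c @ encode_chunks (dict @ [c]) cs)"

definition dict_encoding :: "bool list list \<Rightarrow> bool list" where
  "dict_encoding cs = elias_gamma (length (concat cs)) @ encode_chunks [] cs"

definition mFLD_chunks :: "nat \<Rightarrow> nat \<Rightarrow> 'a list \<Rightarrow> 'a list list" where
  "mFLD_chunks D l s = concat (map (chunks_of l) (chunks_of D s))"

lemma concat_concat_map: "concat (concat xss) = concat (map concat xss)"
  by (induction xss) auto

lemma concat_mFLD_chunks: "concat (mFLD_chunks D l s) = s"
  by (simp add: mFLD_chunks_def concat_concat_map comp_def)

definition mFLD_encoding :: "nat \<Rightarrow> nat \<Rightarrow> bool list \<Rightarrow> bool list" where
  "mFLD_encoding D l s = dict_encoding (mFLD_chunks D l s)"

definition mFLD_length :: "nat \<Rightarrow> nat \<Rightarrow> bool list \<Rightarrow> nat" where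
  "mFLD_length D l s = length (mFLD_encoding D l s)"

definition mFLD_ratio :: "nat \<Rightarrow> nat \<Rightarrow> bool list pmf \<Rightarrow> real" where
  "mFLD_ratio D l p =
     measure_pmf.expectation p (\<lambda>s. real (length s)) /
     measure_pmf.expectation p (\<lambda>s. real (mFLD_length D l s))"

end

theory Submission
  imports Defs "HOL-Library.Sublist" "HOL-Real_Asymp.Real_Asymp"
begin

text \<open>
  If \<open>l = o(log B)\<close>, already the first source block, which is uniformly distributed on
  \<open>{0,1}\<^sup>L\<close>, contains with probability at least \<open>1/2\<close> half of all \<open>2\<^sup>l\<close> possible chunks, so that
  each later full chunk costs at least \<open>l\<close> bits, as a literal or as a flag and a pointer.

  If \<open>l = \<omega>(log B)\<close>, condition on all the source data but the edits. A full chunk then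
  takes any given value with probability at most \<open>(1 - \<delta>)\<^sup>l\<close>, independently of the preceding bits.
  Hence it occurs earlier in the stream with probability at most \<open>B L (1 - \<delta>)\<^sup>l \<rightarrow> 0\<close>, and most full
  chunks are encoded literally.
\<close>

section \<open>Parsing into segments and chunks\<close>

lemma chunks_of_Nil [simp]: "chunks_of n [] = []"
  by (simp add: chunks_of.simps)

lemma chunks_of_append:
  assumes "n > 0" "length xs = n"
  shows "chunks_of n (xs @ ys) = xs # chunks_of n ys"
  using assms by (subst chunks_of.simps) auto

lemma mFLD_chunks_append:
  assumes "D > 0" "length xs = D"
  shows "mFLD_chunks D l (xs @ ys) = chunks_of l xs @ mFLD_chunks D l ys"
  using assms by (simp add: mFLD_chunks_def chunks_of_append)

lemma mFLD_chunks_Nil [simp]: "mFLD_chunks D l [] = []"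
  by (simp add: mFLD_chunks_def)

lemma full_chunks_of:
  assumes "l > 0"
  shows "length y div l \<le> length (filter (\<lambda>c. length c = l) (chunks_of l y))"
proof (induction "length y div l" arbitrary: y)
  case (Suc k)
  define v w where "v = take l y" and "w = drop l y"
  have "l \<le> length y"
    using Suc.hyps(2) assms by (metis div_less leI nat.distinct(1))
  hence y: "y = v @ w" "length v = l" by (auto simp: v_def w_def)
  have "k = length w div l" using Suc.hyps(2) y assms by (simp add: div_add_self1)
  from Suc.hyps(1)[OF this] show ?case
    using y Suc.hyps(2) \<open>k = _\<close> assms by (simp add: chunks_of_append)
qed simp

lemma full_mFLD_chunks:
  assumes "l > 0" "D > 0" "length s = n * D"
  shows "n * (D div l) \<le> length (filter (\<lambda>c. length c = l) (mFLD_chunks D l s))"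
  using assms(3)
proof (induction n arbitrary: s)
  case (Suc n)
  define v w where "v = take D s" and "w = drop D s"
  have s: "s = v @ w" "length v = D" "length w = n * D" using Suc.prems by (auto simp: v_def w_def)
  show ?case
    using Suc.IH[OF s(3)] full_chunks_of[OF assms(1), of v] s assms by (simp add: mFLD_chunks_append)
qed simp

section \<open>Encoding cost with a large dictionary\<close>

text \<open>The witness \<open>dict'\<close> is the dictionary reached after \<open>cs\<close>;
  discarding the output for \<open>cs\<close> only shortens the encoding. Distinctness is carried
  along so that the length of \<open>dict'\<close> can later be read off as the cardinality of its
  set.\<close>

lemma encode_chunks_append_le:
  assumes "distinct dict"
  shows "\<exists>dict'. distinct dict' \<and> set dict' = set dict \<union> set cs \<and>
           length (encode_chunks dict' ds) \<le> length (encode_chunks dict (cs @ ds))"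
  using assms
proof (induction cs arbitrary: dict)
  case (Cons c cs)
  show ?case
  proof (cases "c \<in> set dict")
    case True
    obtain dict' where "distinct dict'" "set dict' = set dict \<union> set cs"
      "length (encode_chunks dict' ds) \<le> length (encode_chunks dict (cs @ ds))"
      using Cons.IH[OF Cons.prems] by blast
    thus ?thesis using True by (intro exI[of _ dict']) auto
  next
    case False
    obtain dict' where "distinct dict'" "set dict' = set (dict @ [c]) \<union> set cs"
      "length (encode_chunks dict' ds) \<le> length (encode_chunks (dict @ [c]) (cs @ ds))"
      using Cons.IH[of "dict @ [c]"] Cons.prems False by auto
    thus ?thesis using False by (intro exI[of _ dict']) auto
  qed
qed auto

lemma length_pointer [simp]: "length (pointer dict c) = ceillog2 (length dict)"
  by (simp add: pointer_def)

text \<open>A literal of length \<open>l\<close> costs \<open>l + 1\<close> bits. A pointer into a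
  dictionary with at least \<open>2 ^ l / 2\<close> entries takes at least \<open>l - 1\<close>
  bits, and the flag makes up the missing one. The dictionary never shrinks, so the hypothesis
  survives each step.\<close>

lemma encode_chunks_large_dict:
  assumes "2 ^ l \<le> 2 * length dict"
  shows "l * length (filter (\<lambda>c. length c = l) cs) \<le> length (encode_chunks dict cs)"
  using assms
proof (induction cs arbitrary: dict)
  case (Cons c cs)
  have "dict \<noteq> []" using Cons.prems by auto
  hence "l \<le> ceillog2 (length dict) + 1"
    using Cons.prems ceillog2_ge_iff[of "length dict" "l - 1"]
    by (cases l) (auto intro: le_less_trans)
  moreover have "2 ^ l \<le> 2 * length (dict @ [c])" using Cons.prems by simp
  ultimately show ?case
    using Cons.IH[of dict] Cons.IH[of "dict @ [c]"] Cons.prems by auto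
qed simp

text \<open>The first block only serves to fill the dictionary and its own cost is dropped. Each
  full chunk of the other \<open>B - 1\<close> blocks then costs at least \<open>l\<close> bits,
  whether repeated or not.\<close>

lemma mFLD_length_large_first_block:
  assumes "l > 0" "L > 0" "B > 0" "length s = B * L"
    and "2 ^ l \<le> 2 * card (set (chunks_of l (take L s)))"
  shows "(B - 1) * (L div l) * l \<le> mFLD_length L l s"
proof -
  define y r where "y = take L s" and "r = drop L s"
  have s: "s = y @ r" "length y = L" "length r = (B - 1) * L"
    using assms by (auto simp: y_def r_def diff_mult_distrib)
  obtain dict' where d: "distinct dict'" "set dict' = set (chunks_of l y)"
      "length (encode_chunks dict' (mFLD_chunks L l r)) \<le>
       length (encode_chunks [] (chunks_of l y @ mFLD_chunks L l r))"
    using encode_chunks_append_le[of "[]" "chunks_of l y"] by auto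
  have "2 ^ l \<le> 2 * length dict'"
    using assms(5) d by (metis distinct_card y_def)
  from encode_chunks_large_dict[OF this, of "mFLD_chunks L l r"]
  have "l * ((B - 1) * (L div l)) \<le> length (encode_chunks dict' (mFLD_chunks L l r))"
    using full_mFLD_chunks[OF assms(1,2) s(3)] by (meson le_trans mult_le_mono2)
  thus ?thesis
    using d(3) assms(2) s
    by (simp add: mFLD_length_def mFLD_encoding_def dict_encoding_def mFLD_chunks_append mult_ac)
qed

section \<open>Cost of the literals\<close>

text \<open>A lower estimate for the literals, with \<open>u\<close> the text read so far. Testing
  for an occurrence anywhere in \<open>u\<close>, instead of membership in the dictionary, counts
  fewer chunks as new, but makes the test depend only on positions in the stream.\<close>

fun new_cost :: "bool list \<Rightarrow> bool list list \<Rightarrow> nat" where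
  "new_cost u [] = 0"
| "new_cost u (c # cs) = (if sublist c u then 0 else length c) + new_cost (u @ c) cs"

lemma new_cost_append: "new_cost u (cs @ ds) = new_cost u cs + new_cost (u @ concat cs) ds"
  by (induction cs arbitrary: u) auto

text \<open>All dictionary entries occur in the text read so far, an invariant kept as that text
  grows. A chunk that does not occur there is therefore absent from the dictionary and written out
  in full.\<close>

lemma new_cost_le_encode_chunks:
  assumes "\<And>d. d \<in> set dict \<Longrightarrow> sublist d u"
  shows "new_cost u cs \<le> length (encode_chunks dict cs)"
  using assms
proof (induction cs arbitrary: u dict)
  case (Cons c cs)
  have ext: "sublist d (u @ c)" if "d \<in> set dict" for d
    using Cons.prems[OF that] by (meson sublist_append_rightI sublist_order.order_trans)
  show ?case
    using Cons.IH[of dict "u @ c"] Cons.IH[of "dict @ [c]" "u @ c"] Cons.prems ext by fastforce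
qed simp

text \<open>Unfolds the recursion into a sum over the positions \<open>i * l\<close> of the full
  chunks; a shorter last chunk is dropped, hence the inequality.\<close>

lemma new_cost_chunks_of:
  assumes "l > 0"
  shows "(\<Sum>i<length y div l. if sublist (take l (drop (i * l) y)) (u @ take (i * l) y) then 0 else l)
         \<le> new_cost u (chunks_of l y)"
proof (induction "length y div l" arbitrary: u y)
  case (Suc k)
  define v w where "v = take l y" and "w = drop l y"
  have "l \<le> length y"
    using Suc.hyps(2) assms by (metis div_less leI nat.distinct(1))
  hence y: "y = v @ w" "length v = l" by (auto simp: v_def w_def)
  have k: "k = length w div l" using Suc.hyps(2) y assms by (simp add: div_add_self1)
  have "(\<Sum>i<length y div l. if sublist (take l (drop (i * l) y)) (u @ take (i * l) y) then 0 else l)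
      = (if sublist v u then 0 else l) +
        (\<Sum>i<length w div l. if sublist (take l (drop (i * l) w)) ((u @ v) @ take (i * l) w) then 0 else l)"
    unfolding Suc.hyps(2)[symmetric] k[symmetric] using y by (simp add: sum.lessThan_Suc_shift del: sum.lessThan_Suc)
  also have "\<dots> \<le> new_cost u (chunks_of l y)"
    using Suc.hyps(1)[OF k, of "u @ v"] y assms by (simp add: chunks_of_append)
  finally show ?case .
qed simp

lemma new_cost_mFLD_chunks:
  assumes "l > 0" "L > 0" "length s = B * L"
  shows "(\<Sum>b<B. \<Sum>i<L div l. if sublist (take l (drop (b * L + i * l) s)) (u @ take (b * L + i * l) s)
            then 0 else l) \<le> new_cost u (mFLD_chunks L l s)"
  using assms(3)
proof (induction B arbitrary: u s)
  case (Suc B)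
  define v w where "v = take L s" and "w = drop L s"
  have s: "s = v @ w" "length v = L" "length w = B * L" using Suc.prems by (auto simp: v_def w_def)
  define g :: "bool list \<Rightarrow> nat \<Rightarrow> bool list \<Rightarrow> nat"
    where "g = (\<lambda>u q s. if sublist (take l (drop q s)) (u @ take q s) then 0 else l)"
  \<comment> \<open>A full chunk of the first segment ends at position at most \<open>L\<close>, so
    neither it nor the text before it reaches into \<open>w\<close>.\<close>
  have eq: "g u (i * l) s = g u (i * l) v" if "i < L div l" for i
  proof -
    have "Suc i * l \<le> L div l * l" using that by (intro mult_le_mono1) simp
    also have "\<dots> \<le> L" by simp
    finally have "i * l + l \<le> L" by simp
    thus ?thesis using s by (simp add: g_def)
  qed
  have "(\<Sum>b<Suc B. \<Sum>i<L div l. g u (b * L + i * l) s)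
      = (\<Sum>i<L div l. g u (i * l) s) + (\<Sum>b<B. \<Sum>i<L div l. g (u @ v) (b * L + i * l) w)"
    using s by (simp add: sum.lessThan_Suc_shift g_def add.assoc del: sum.lessThan_Suc)
  also have "(\<Sum>i<L div l. g u (i * l) s) = (\<Sum>i<L div l. g u (i * l) v)"
    by (intro sum.cong) (auto simp: eq)
  also have "(\<Sum>i<L div l. g u (i * l) v) + (\<Sum>b<B. \<Sum>i<L div l. g (u @ v) (b * L + i * l) w)
      \<le> new_cost u (chunks_of l v) + new_cost (u @ v) (mFLD_chunks L l w)"
    using Suc.IH[OF s(3), of "u @ v"] new_cost_chunks_of[OF assms(1), of v u] s
    by (intro add_mono) (simp_all add: g_def)
  also have "\<dots> = new_cost u (mFLD_chunks L l s)"
    using s assms by (simp add: mFLD_chunks_append new_cost_append)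
  finally show ?case by (simp add: g_def)
qed simp

lemma mFLD_length_ge_new_chunks:
  assumes "l > 0" "L > 0" "length s = B * L"
  shows "(\<Sum>b<B. \<Sum>i<L div l. if sublist (take l (drop (b * L + i * l) s)) (take (b * L + i * l) s)
            then 0 else l) \<le> mFLD_length L l s"
  using new_cost_mFLD_chunks[OF assms, of "[]"] new_cost_le_encode_chunks[of "[]" "[]" "mFLD_chunks L l s"]
  by (simp add: mFLD_length_def mFLD_encoding_def dict_encoding_def)

section \<open>Distinct chunks in a uniform block\<close>

lemma finite_length_eq [simp]: "finite {xs :: bool list. length xs = n}"
  and card_length_eq: "card {xs :: bool list. length xs = n} = 2 ^ n"
  using finite_lists_length_eq[of "UNIV :: bool set" n] card_lists_length_eq[of "UNIV :: bool set" n]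
  by auto

text \<open>Each of the first \<open>m\<close> chunks has to avoid \<open>z\<close>, which leaves
  \<open>2 ^ l - 1\<close> values for it; the remaining \<open>r\<close> bits are bounded as if they
  were free.\<close>

lemma card_missing_chunk:
  fixes z :: "bool list"
  assumes "l > 0" "length z = l"
  shows "card {y. length y = m * l + r \<and> z \<notin> set (chunks_of l y)} \<le> (2 ^ l - 1) ^ m * 2 ^ r"
proof (induction m)
  case 0
  have "card {y. length y = r \<and> z \<notin> set (chunks_of l y)} \<le> card {y::bool list. length y = r}"
    by (intro card_mono) auto
  thus ?case by (simp add: card_length_eq)
next
  case (Suc m)
  define S where "S = {y. length y = m * l + r \<and> z \<notin> set (chunks_of l y)}"
  define T where "T = {y :: bool list. length y = l} - {z}"
  have fin: "finite S" "finite T"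
    unfolding S_def T_def by (auto intro: finite_subset[OF _ finite_length_eq])
  have "{y. length y = Suc m * l + r \<and> z \<notin> set (chunks_of l y)} \<subseteq> (\<lambda>(a, b). a @ b) ` (T \<times> S)"
  proof
    fix y assume "y \<in> {y. length y = Suc m * l + r \<and> z \<notin> set (chunks_of l y)}"
    hence y: "length y = Suc m * l + r" "z \<notin> set (chunks_of l y)" by auto
    have "chunks_of l y = take l y # chunks_of l (drop l y)"
      using y assms chunks_of_append[of l "take l y" "drop l y"] by simp
    hence "take l y \<in> T" "drop l y \<in> S" using y assms by (auto simp: T_def S_def)
    thus "y \<in> (\<lambda>(a, b). a @ b) ` (T \<times> S)"
      by (intro image_eqI[of _ _ "(take l y, drop l y)"]) auto
  qed
  hence "card {y. length y = Suc m * l + r \<and> z \<notin> set (chunks_of l y)} \<le> card (T \<times> S)"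
    using fin by (meson card_image_le card_mono finite_SigmaI finite_imageI le_trans)
  also have "\<dots> = (2 ^ l - 1) * card S"
    using assms by (simp add: card_cartesian_product T_def card_length_eq)
  also have "\<dots> \<le> (2 ^ l - 1) * ((2 ^ l - 1) ^ m * 2 ^ r)"
    using Suc by (intro mult_le_mono2) (simp add: S_def)
  finally show ?case by (simp add: mult_ac)
qed

text \<open>Double counting of the pairs of a block \<open>y\<close> and a value \<open>z\<close>
  missing from it: a bad block misses at least half of the \<open>2 ^ l\<close> values, while
  \<open>card_missing_chunk\<close> bounds the number of blocks that miss a given value.\<close>

lemma card_few_chunks:
  assumes "l > 0"
  shows "card {y :: bool list. length y = m * l + r \<and> 2 * card (set (chunks_of l y)) < 2 ^ l}
         \<le> 2 * ((2 ^ l - 1) ^ m * 2 ^ r)"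
proof -
  define U where "U = {y :: bool list. length y = m * l + r}"
  define Z where "Z = {z :: bool list. length z = l}"
  define bad where "bad = {y \<in> U. 2 * card (set (chunks_of l y)) < 2 ^ l}"
  have fin: "finite U" "finite Z" "finite bad"
    by (auto simp: U_def Z_def bad_def)
  have missing: "2 ^ l \<le> 2 * card {z \<in> Z. z \<notin> set (chunks_of l y)}" if "y \<in> bad" for y
  proof -
    have "card Z \<le> card ({z \<in> Z. z \<notin> set (chunks_of l y)} \<union> set (chunks_of l y))"
      using fin by (intro card_mono) auto
    also have "\<dots> \<le> card {z \<in> Z. z \<notin> set (chunks_of l y)} + card (set (chunks_of l y))"
      by (rule card_Un_le)
    finally show ?thesis using that by (simp add: Z_def card_length_eq bad_def)
  qed
  have "2 ^ l * card bad = (\<Sum>y\<in>bad. 2 ^ l)" by simp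
  also have "\<dots> \<le> (\<Sum>y\<in>bad. 2 * card {z \<in> Z. z \<notin> set (chunks_of l y)})"
    by (intro sum_mono missing)
  also have "\<dots> \<le> (\<Sum>y\<in>U. 2 * card {z \<in> Z. z \<notin> set (chunks_of l y)})"
    using fin by (intro sum_mono2) (auto simp: bad_def)
  also have "\<dots> = 2 * (\<Sum>y\<in>U. \<Sum>z\<in>Z. if z \<notin> set (chunks_of l y) then 1 else 0)"
    using fin by (simp add: sum_distrib_left sum.If_cases Int_def)
  also have "\<dots> = 2 * (\<Sum>z\<in>Z. \<Sum>y\<in>U. if z \<notin> set (chunks_of l y) then 1 else 0)"
    by (subst sum.swap) simp
  also have "\<dots> = 2 * (\<Sum>z\<in>Z. card {y. length y = m * l + r \<and> z \<notin> set (chunks_of l y)})"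
    using fin by (simp add: sum.If_cases Int_def U_def)
  also have "\<dots> \<le> 2 * (\<Sum>z\<in>Z. (2 ^ l - 1) ^ m * 2 ^ r)"
    by (intro mult_le_mono2 sum_mono card_missing_chunk) (auto simp: Z_def assms)
  also have "\<dots> = 2 ^ l * (2 * ((2 ^ l - 1) ^ m * 2 ^ r))"
    by (simp add: Z_def card_length_eq)
  finally have "card bad \<le> 2 * ((2 ^ l - 1) ^ m * 2 ^ r)" by simp
  thus ?thesis by (simp add: bad_def U_def)
qed

text \<open>With \<open>m = L div l\<close>, the count gives the bound
  \<open>2 * (1 - 1 / 2 ^ l) ^ m\<close>, which is at most \<open>2 * exp (- m / 2 ^ l)\<close>. The
  factor 2 in the hypothesis turns this into \<open>2 * exp (- 2)\<close>, below
  \<open>1 / 2\<close>.\<close>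

lemma prob_few_chunks:
  assumes "l > 0" "2 * 2 ^ l \<le> L div l"
  shows "measure_pmf.prob (pmf_of_set {y :: bool list. length y = L}) {y. 2 * card (set (chunks_of l y)) < 2 ^ l}
         \<le> 1 / 2"
proof -
  define m r where "m = L div l" and "r = L mod l"
  define q :: real where "q = 2 ^ l"
  have L: "L = m * l + r" by (simp add: m_def r_def)
  have q: "q \<ge> 1" by (simp add: q_def)
  have "measure_pmf.prob (pmf_of_set {y :: bool list. length y = L}) {y. 2 * card (set (chunks_of l y)) < 2 ^ l}
      = real (card {y :: bool list. length y = m * l + r \<and> 2 * card (set (chunks_of l y)) < 2 ^ l}) / 2 ^ L"
    using Ex_list_of_length[of L]
    by (subst measure_pmf_of_set) (auto simp: card_length_eq L[symmetric] Int_def)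
  also have "\<dots> \<le> real (2 * ((2 ^ l - 1) ^ m * 2 ^ r)) / 2 ^ L"
    by (intro divide_right_mono of_nat_mono card_few_chunks assms) simp
  also have "\<dots> = 2 * ((q - 1) ^ m * 2 ^ r) / (q ^ m * 2 ^ r)"
    by (simp add: L power_add power_mult mult.commute[of m] q_def of_nat_diff)
  also have "\<dots> = 2 * (1 - 1 / q) ^ m"
  proof -
    have "1 - 1 / q = (q - 1) / q" using q by (simp add: diff_divide_distrib)
    thus ?thesis by (simp add: power_divide)
  qed
  also have "\<dots> \<le> 2 * exp (- 1 / q) ^ m"
    using q exp_ge_add_one_self[of "- 1 / q"] by (intro mult_left_mono power_mono) auto
  also have "\<dots> = 2 * exp (- (real m / q))"
    by (simp add: exp_of_nat_mult[symmetric])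
  also have "\<dots> \<le> 2 * exp (- 2)"
  proof -
    have "real (2 * 2 ^ l) \<le> real m" using assms(2) unfolding m_def by (rule of_nat_mono)
    hence "2 * q \<le> real m" by (simp add: q_def)
    thus ?thesis using q by (simp add: field_simps)
  qed
  also have "\<dots> \<le> 1 / 2"
  proof -
    have "(2::real) * 2 \<le> exp 1 * exp 1"
      using exp_ge_add_one_self[of 1] by (intro mult_mono) auto
    also have "\<dots> = exp 2" by (simp add: exp_add[symmetric])
    finally show ?thesis by (simp add: exp_minus field_simps)
  qed
  finally show ?thesis .
qed

section \<open>The edit channel\<close>

text \<open>The form in which conditioning is used: a bound that is uniform in the outcome of
  \<open>M\<close> passes to the mixture.\<close>

lemma prob_bind_pmf_le:
  assumes "\<And>x. x \<in> set_pmf M \<Longrightarrow> measure_pmf.prob (f x) E \<le> c"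
  shows "measure_pmf.prob (bind_pmf M f) E \<le> c"
proof -
  \<comment> \<open>Some outcome exists, and it forces \<open>c\<close> to be nonnegative, as the
    passage to \<open>ennreal\<close> requires.\<close>
  obtain x where "x \<in> set_pmf M" using set_pmf_not_empty[of M] by blast
  hence c: "0 \<le> c" using assms[of x] measure_nonneg order_trans by blast
  have "emeasure (measure_pmf (bind_pmf M f)) E \<le> (\<integral>\<^sup>+x. ennreal c \<partial>measure_pmf M)"
    unfolding emeasure_bind_pmf
    by (intro nn_integral_mono_AE AE_pmfI)
       (use assms c in \<open>simp add: measure_pmf.emeasure_eq_measure\<close>)
  also have "\<dots> = ennreal c"
    by (simp add: measure_pmf.emeasure_space_1)
  finally show ?thesis
    using c by (simp add: measure_pmf.emeasure_eq_measure)
qed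

lemma edit_pmf_Nil [simp]: "edit_pmf \<delta> [] = return_pmf []"
  by (simp add: edit_pmf_def)

text \<open>Flips at different positions are independent, so the edits of a single chunk can be
  separated from all the others.\<close>

lemma edit_pmf_append:
  "edit_pmf \<delta> (x @ y) = do {u \<leftarrow> edit_pmf \<delta> x; v \<leftarrow> edit_pmf \<delta> y; return_pmf (u @ v)}"
proof -
  have "edit_pmf \<delta> (x @ y) = do {f \<leftarrow> replicate_pmf (length x) (bernoulli_pmf \<delta>);
      g \<leftarrow> replicate_pmf (length y) (bernoulli_pmf \<delta>); return_pmf (map2 (\<noteq>) (x @ y) (f @ g))}"
    by (simp add: edit_pmf_def replicate_pmf_distrib map_bind_pmf)
  \<comment> \<open>On the support \<open>f\<close> is as long as \<open>x\<close>, so the zip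
    splits where \<open>x\<close> ends.\<close>
  also have "\<dots> = do {f \<leftarrow> replicate_pmf (length x) (bernoulli_pmf \<delta>);
      g \<leftarrow> replicate_pmf (length y) (bernoulli_pmf \<delta>); return_pmf (map2 (\<noteq>) x f @ map2 (\<noteq>) y g)}"
    by (intro bind_pmf_cong refl) (auto simp: set_replicate_pmf)
  also have "\<dots> = do {u \<leftarrow> edit_pmf \<delta> x; v \<leftarrow> edit_pmf \<delta> y; return_pmf (u @ v)}"
    by (simp add: edit_pmf_def bind_map_pmf)
  finally show ?thesis .
qed

lemma length_edit_pmf: "y \<in> set_pmf (edit_pmf \<delta> x) \<Longrightarrow> length y = length x"
  by (auto simp: edit_pmf_def set_replicate_pmf)

text \<open>Each bit takes its prescribed value with probability \<open>\<delta>\<close> or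
  \<open>1 - \<delta>\<close>, and the latter is the larger since
  \<open>\<delta> < 1 / 2\<close>.\<close>

lemma pmf_edit_le:
  assumes "0 < \<delta>" "\<delta> < 1 / 2"
  shows "pmf (edit_pmf \<delta> x) z \<le> (1 - \<delta>) ^ length x"
proof (induction x arbitrary: z)
  case (Cons a x)
  have [simp]: "edit_pmf \<delta> [a] = map_pmf (\<lambda>f. [a \<noteq> f]) (bernoulli_pmf \<delta>)"
    by (simp add: edit_pmf_def bind_return_pmf map_bind_pmf) (simp add: map_pmf_def)
  \<comment> \<open>The flip of the first bit is moved to the end, so that for a fixed tail
    \<open>v\<close> it contributes the factor \<open>1 - \<delta>\<close>.\<close>
  have eq: "edit_pmf \<delta> (a # x) = do {v \<leftarrow> edit_pmf \<delta> x; f \<leftarrow> bernoulli_pmf \<delta>; return_pmf ((a \<noteq> f) # v)}"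
    using edit_pmf_append[of \<delta> "[a]" x] by (subst bind_commute_pmf) (simp add: bind_map_pmf)
  show ?case
  proof (cases z)
    case Nil
    have "pmf (edit_pmf \<delta> (a # x)) z = 0"
      using length_edit_pmf[of z \<delta> "a # x"] Nil by (auto simp: pmf_eq_0_set_pmf)
    thus ?thesis using assms by simp
  next
    case (Cons b w)
    have inner: "pmf (bind_pmf (bernoulli_pmf \<delta>) (\<lambda>f. return_pmf ((a \<noteq> f) # v))) z \<le> (1 - \<delta>) * indicator {w} v" for v
    proof -
      let ?g = "\<lambda>f. (a \<noteq> f) # v"
      have "pmf (map_pmf ?g (bernoulli_pmf \<delta>)) z \<le> (1 - \<delta>) * indicator {w} v"
      proof (cases "v = w")
        case True
        \<comment> \<open>The only flip that turns \<open>a\<close> into \<open>b\<close> is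
          \<open>a \<noteq> b\<close>.\<close>
        have "z = ?g (a \<noteq> b)" using True Cons by auto
        moreover have "inj ?g" by (auto simp: inj_def)
        ultimately have "pmf (map_pmf ?g (bernoulli_pmf \<delta>)) z = pmf (bernoulli_pmf \<delta>) (a \<noteq> b)"
          using pmf_map_inj'[of ?g "bernoulli_pmf \<delta>" "a \<noteq> b"] by metis
        also have "\<dots> \<le> 1 - \<delta>" using assms by (cases "a \<noteq> b") auto
        finally show ?thesis using True by simp
      next
        case False
        hence "pmf (map_pmf ?g (bernoulli_pmf \<delta>)) z = 0"
          using Cons by (auto simp: pmf_eq_0_set_pmf)
        thus ?thesis using assms by (simp add: indicator_def)
      qed
      thus ?thesis by (simp add: map_pmf_def)
    qed
    have "pmf (edit_pmf \<delta> (a # x)) z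
        \<le> measure_pmf.expectation (edit_pmf \<delta> x) (\<lambda>v. (1 - \<delta>) * indicator {w} v)"
      unfolding eq pmf_bind[of "edit_pmf \<delta> x"]
      by (intro integral_mono inner measure_pmf.integrable_const_bound[where B = 1] AE_I2)
         (use assms in \<open>auto simp: pmf_le_1 indicator_def\<close>)
    also have "\<dots> = (1 - \<delta>) * pmf (edit_pmf \<delta> x) w"
      by (simp add: measure_pmf_single)
    also have "\<dots> \<le> (1 - \<delta>) ^ length (a # x)"
      using Cons.IH[of w] assms by simp
    finally show ?thesis .
  qed
qed (simp add: pmf_le_1)

text \<open>Such a substring is determined by its starting position, which is below
  \<open>length u\<close> because \<open>l > 0\<close>.\<close>

lemma sublists_of_length:
  assumes "l > 0"
  shows "finite {v. length v = l \<and> sublist v u}"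
    and "card {v. length v = l \<and> sublist v u} \<le> length u"
proof -
  have "{v. length v = l \<and> sublist v u} \<subseteq> (\<lambda>p. take l (drop p u)) ` {..<length u}"
  proof
    fix v assume "v \<in> {v. length v = l \<and> sublist v u}"
    then obtain ps ss where "u = ps @ v @ ss" "length v = l" by (auto simp: sublist_def)
    thus "v \<in> (\<lambda>p. take l (drop p u)) ` {..<length u}"
      using assms by (intro image_eqI[of _ _ "length ps"]) auto
  qed
  thus "finite {v. length v = l \<and> sublist v u}"
    and "card {v. length v = l \<and> sublist v u} \<le> length u"
    using surj_card_le[of "{..<length u}"] by (auto dest: finite_subset)
qed

text \<open>Union bound: once the edited prefix is fixed, it has at most \<open>q\<close> substrings
  of length \<open>l\<close>, and the independently edited chunk equals each of them with
  probability at most \<open>(1 - \<delta>) ^ l\<close>.\<close>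

lemma prob_edit_sublist_le:
  assumes \<delta>: "0 < \<delta>" "\<delta> < 1 / 2" and l: "l > 0" and x: "q + l \<le> length x"
  shows "measure_pmf.prob (edit_pmf \<delta> x) {s. sublist (take l (drop q s)) (take q s)}
         \<le> real q * (1 - \<delta>) ^ l"
proof -
  define E where "E = {s. sublist (take l (drop q s)) (take q s :: bool list)}"
  define x1 x2 x3 where "x1 = take q x" and "x2 = take l (drop q x)" and "x3 = drop (q + l) x"
  have xs: "x = x1 @ x2 @ x3"
    by (simp add: x1_def x2_def x3_def add.commute[of q] drop_drop[symmetric] del: drop_drop)
  have len: "length x1 = q" "length x2 = l" using x by (auto simp: x1_def x2_def)
  have "edit_pmf \<delta> x = do {u \<leftarrow> edit_pmf \<delta> x1; v \<leftarrow> edit_pmf \<delta> x2; w \<leftarrow> edit_pmf \<delta> x3; return_pmf (u @ v @ w)}"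
    unfolding xs by (simp add: edit_pmf_append bind_assoc_pmf bind_return_pmf)
  \<comment> \<open>The chunk is drawn last, after the text on both sides of it.\<close>
  also have "\<dots> = do {u \<leftarrow> edit_pmf \<delta> x1; w \<leftarrow> edit_pmf \<delta> x3; map_pmf (\<lambda>v. u @ v @ w) (edit_pmf \<delta> x2)}"
    unfolding map_pmf_def by (subst (2) bind_commute_pmf) simp
  finally have eq: "edit_pmf \<delta> x = \<dots>" .
  have "measure_pmf.prob (edit_pmf \<delta> x) E \<le> real q * (1 - \<delta>) ^ l"
    unfolding eq
  proof (intro prob_bind_pmf_le)
    fix u w assume u: "u \<in> set_pmf (edit_pmf \<delta> x1)"
    define S where "S = {v. length v = l \<and> sublist v u}"
    have lu: "length u = q" using length_edit_pmf[OF u] len by simp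
    have "measure_pmf.prob (map_pmf (\<lambda>v. u @ v @ w) (edit_pmf \<delta> x2)) E
        = measure_pmf.prob (edit_pmf \<delta> x2) {v. u @ v @ w \<in> E}"
      by (simp add: vimage_def)
    also have "\<dots> \<le> measure_pmf.prob (edit_pmf \<delta> x2) S"
      by (intro measure_pmf.finite_measure_mono_AE AE_pmfI)
         (use len lu in \<open>auto simp: S_def E_def dest: length_edit_pmf\<close>)
    also have "\<dots> = (\<Sum>v\<in>S. pmf (edit_pmf \<delta> x2) v)"
      using sublists_of_length[OF l] by (simp add: S_def measure_measure_pmf_finite)
    also have "\<dots> \<le> (\<Sum>v\<in>S. (1 - \<delta>) ^ l)"
      using pmf_edit_le[OF \<delta>, of x2] len by (intro sum_mono) simp
    also have "\<dots> = real (card S) * (1 - \<delta>) ^ l" by simp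
    also have "\<dots> \<le> real q * (1 - \<delta>) ^ l"
      using sublists_of_length(2)[OF l, of u] \<delta> lu
      by (intro mult_right_mono) (simp_all add: S_def)
    finally show "measure_pmf.prob (map_pmf (\<lambda>v. u @ v @ w) (edit_pmf \<delta> x2)) E \<le> real q * (1 - \<delta>) ^ l" .
  qed
  thus ?thesis by (simp add: E_def)
qed

section \<open>The distribution of the data stream\<close>

text \<open>Drawing all blocks first and then editing their concatenation in one go is the same as
  editing block by block. In this order the unedited stream can be fixed while the edits stay
  random.\<close>

lemma bind_replicate_pmf_edit:
  "bind_pmf (replicate_pmf n (bind_pmf J (edit_pmf \<delta>))) (\<lambda>Y. return_pmf (concat Y))
   = bind_pmf (replicate_pmf n J) (\<lambda>X. edit_pmf \<delta> (concat X))"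
proof (induction n)
  case (Suc n)
  have "bind_pmf (replicate_pmf (Suc n) (bind_pmf J (edit_pmf \<delta>))) (\<lambda>Y. return_pmf (concat Y))
      = do {x \<leftarrow> J; u \<leftarrow> edit_pmf \<delta> x;
            v \<leftarrow> bind_pmf (replicate_pmf n (bind_pmf J (edit_pmf \<delta>))) (\<lambda>Y. return_pmf (concat Y));
            return_pmf (u @ v)}"
    by (simp add: bind_assoc_pmf bind_return_pmf)
  also have "\<dots> = do {x \<leftarrow> J; u \<leftarrow> edit_pmf \<delta> x; X \<leftarrow> replicate_pmf n J;
            v \<leftarrow> edit_pmf \<delta> (concat X); return_pmf (u @ v)}"
    unfolding Suc.IH by (simp add: bind_assoc_pmf)
  also have "\<dots> = do {x \<leftarrow> J; X \<leftarrow> replicate_pmf n J; u \<leftarrow> edit_pmf \<delta> x;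
            v \<leftarrow> edit_pmf \<delta> (concat X); return_pmf (u @ v)}"
    by (subst (2) bind_commute_pmf) simp
  also have "\<dots> = bind_pmf (replicate_pmf (Suc n) J) (\<lambda>X. edit_pmf \<delta> (concat X))"
    by (simp add: bind_assoc_pmf bind_return_pmf edit_pmf_append)
  finally show ?case .
qed (simp add: bind_return_pmf)

lemma source_pmf_eq:
  "source_pmf A B L \<delta> = do {
     X \<leftarrow> replicate_pmf A (pmf_of_set {x. length x = L});
     Z \<leftarrow> replicate_pmf B (map_pmf ((!) X) (pmf_of_set {..<A}));
     edit_pmf \<delta> (concat Z)}"
  unfolding source_pmf_def
  by (subst bind_replicate_pmf_edit[symmetric]) (simp add: bind_map_pmf)

lemma set_pmf_of_set_length [simp]:
  "set_pmf (pmf_of_set {x :: bool list. length x = L}) = {x. length x = L}"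
  using Ex_list_of_length[of L] by (intro set_pmf_of_set) auto

lemma set_pmf_of_set_lessThan [simp]: "A > 0 \<Longrightarrow> set_pmf (pmf_of_set {..<A}) = {..<A :: nat}"
  by (intro set_pmf_of_set) auto

lemma length_concat_source:
  assumes "A > 0" "X \<in> set_pmf (replicate_pmf A (pmf_of_set {x :: bool list. length x = L}))"
    and "Z \<in> set_pmf (replicate_pmf B (map_pmf ((!) X) (pmf_of_set {..<A})))"
  shows "length (concat Z) = B * L"
proof -
  have "set Z \<subseteq> {x. length x = L}" "length Z = B"
    using assms by (auto simp: set_replicate_pmf lists_eq_set subset_iff)
  thus ?thesis
    by (induction Z arbitrary: B) auto
qed

lemma length_source_pmf:
  assumes "A > 0" "s \<in> set_pmf (source_pmf A B L \<delta>)"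
  shows "length s = B * L"
  using assms(2) unfolding source_pmf_eq
  by (auto dest!: length_edit_pmf length_concat_source[OF assms(1)])

lemma prob_source_sublist_le:
  assumes "0 < \<delta>" "\<delta> < 1 / 2" "l > 0" "A > 0" "q + l \<le> B * L"
  shows "measure_pmf.prob (source_pmf A B L \<delta>) {s. sublist (take l (drop q s)) (take q s)}
         \<le> real q * (1 - \<delta>) ^ l"
  unfolding source_pmf_eq
  by (intro prob_bind_pmf_le prob_edit_sublist_le)
     (use assms in \<open>auto simp: length_concat_source\<close>)

text \<open>For a fixed flip pattern, the bitwise exclusive or with it is an involution on the
  strings of length \<open>L\<close>, hence preserves the uniform distribution.\<close>

lemma edit_pmf_uniform:
  "bind_pmf (pmf_of_set {x. length x = L}) (edit_pmf \<delta>) = pmf_of_set {x. length x = L}"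
proof -
  let ?U = "pmf_of_set {x :: bool list. length x = L}"
  let ?R = "replicate_pmf L (bernoulli_pmf \<delta>)"
  have "bind_pmf ?U (edit_pmf \<delta>) = bind_pmf ?U (\<lambda>x. bind_pmf ?R (\<lambda>f. return_pmf (map2 (\<noteq>) x f)))"
    by (intro bind_pmf_cong refl) (simp add: edit_pmf_def map_pmf_def)
  also have "\<dots> = bind_pmf ?R (\<lambda>f. map_pmf (\<lambda>x. map2 (\<noteq>) x f) ?U)"
    by (subst bind_commute_pmf) (simp add: map_pmf_def)
  also have "\<dots> = bind_pmf ?R (\<lambda>f. ?U)"
  proof (intro bind_pmf_cong refl)
    fix f assume "f \<in> set_pmf ?R"
    hence f: "length f = L" by (simp add: set_replicate_pmf)
    have inv: "map2 (\<noteq>) (map2 (\<noteq>) x f) f = x" if "length x = L" for x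
      using that f by (intro nth_equalityI) auto
    have "bij_betw (\<lambda>x. map2 (\<noteq>) x f) {x. length x = L} {x. length x = L}"
      using f inv by (intro bij_betwI[where g = "\<lambda>x. map2 (\<noteq>) x f"]) auto
    thus "map_pmf (\<lambda>x. map2 (\<noteq>) x f) ?U = ?U"
      using Ex_list_of_length[of L] by (intro map_pmf_of_set_bij_betw) auto
  qed
  also have "\<dots> = ?U" by simp
  finally show ?thesis .
qed

lemma map_nth_replicate_pmf:
  assumes "j < n"
  shows "map_pmf (\<lambda>X. X ! j) (replicate_pmf n p) = p"
  using assms
proof (induction n arbitrary: j)
  case (Suc n)
  show ?case
  proof (cases j)
    case 0
    thus ?thesis by (simp add: map_bind_pmf bind_return_pmf')
  next
    case (Suc i)
    have "map_pmf (\<lambda>X. X ! j) (replicate_pmf (Suc n) p) = map_pmf (\<lambda>X. X ! i) (replicate_pmf n p)"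
      using Suc by (simp add: map_bind_pmf map_pmf_def[symmetric] map_pmf_comp)
    thus ?thesis using Suc Suc.IH Suc.prems by simp
  qed
qed simp

text \<open>Whichever index the first block draws, the symbol behind it is uniform, and editing
  keeps it uniform.\<close>

lemma take_source_pmf:
  assumes "A > 0" "B > 0"
  shows "map_pmf (take L) (source_pmf A B L \<delta>) = pmf_of_set {x. length x = L}"
proof -
  let ?U = "pmf_of_set {x :: bool list. length x = L}"
  obtain B' where B: "B = Suc B'" using assms by (cases B) auto
  have "map_pmf (take L) (source_pmf A B L \<delta>) = do {
     X \<leftarrow> replicate_pmf A ?U; j \<leftarrow> pmf_of_set {..<A}; u \<leftarrow> edit_pmf \<delta> (X ! j);
     Y \<leftarrow> replicate_pmf B' (do {j \<leftarrow> pmf_of_set {..<A}; edit_pmf \<delta> (X ! j)});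
     return_pmf (take L (u @ concat Y))}"
    by (simp add: source_pmf_def B map_bind_pmf bind_assoc_pmf bind_return_pmf)
  also have "\<dots> = do {
     X \<leftarrow> replicate_pmf A ?U; j \<leftarrow> pmf_of_set {..<A}; u \<leftarrow> edit_pmf \<delta> (X ! j);
     Y \<leftarrow> replicate_pmf B' (do {j \<leftarrow> pmf_of_set {..<A}; edit_pmf \<delta> (X ! j)});
     return_pmf u}"
  \<comment> \<open>The edited first block \<open>u\<close> has length exactly \<open>L\<close>, so
    \<open>take L\<close> removes all later blocks.\<close>
  proof (intro bind_pmf_cong refl, goal_cases)
    case (1 X j u Y)
    have "length (X ! j) = L"
      using 1 assms by (auto simp: set_replicate_pmf lists_eq_set subset_iff)
    thus ?case using length_edit_pmf[OF 1(3)] by simp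
  qed
  also have "\<dots> = do {X \<leftarrow> replicate_pmf A ?U; j \<leftarrow> pmf_of_set {..<A}; edit_pmf \<delta> (X ! j)}"
    by (simp add: bind_return_pmf')
  \<comment> \<open>With \<open>j\<close> drawn before \<open>X\<close>, only the marginal of a
    single symbol matters.\<close>
  also have "\<dots> = do {j \<leftarrow> pmf_of_set {..<A}; x \<leftarrow> map_pmf (\<lambda>X. X ! j) (replicate_pmf A ?U); edit_pmf \<delta> x}"
    by (subst bind_commute_pmf) (simp add: bind_map_pmf)
  also have "\<dots> = do {j \<leftarrow> pmf_of_set {..<A}; ?U}"
  proof (intro bind_pmf_cong refl)
    fix j assume "j \<in> set_pmf (pmf_of_set {..<A})"
    hence "j < A" using assms by (subst (asm) set_pmf_of_set) auto
    thus "bind_pmf (map_pmf (\<lambda>X. X ! j) (replicate_pmf A ?U)) (edit_pmf \<delta>) = ?U"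
      by (simp add: map_nth_replicate_pmf edit_pmf_uniform)
  qed
  finally show ?thesis by simp
qed

section \<open>Expected encoding length and compression ratio\<close>

text \<open>The support lies in the finite set of strings of length \<open>B * L\<close>.\<close>

lemma integrable_source_pmf:
  fixes f :: "bool list \<Rightarrow> real"
  assumes "A > 0"
  shows "integrable (measure_pmf (source_pmf A B L \<delta>)) f"
  using length_source_pmf[OF assms]
  by (intro integrable_measure_pmf_finite finite_subset[OF _ finite_length_eq]) auto

lemma expectation_length_source:
  assumes "A > 0"
  shows "measure_pmf.expectation (source_pmf A B L \<delta>) (\<lambda>s. real (length s)) = real B * real L"
proof -
  have "measure_pmf.expectation (source_pmf A B L \<delta>) (\<lambda>s. real (length s))
      = measure_pmf.expectation (source_pmf A B L \<delta>) (\<lambda>s. real B * real L)"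
    by (intro integral_cong_AE AE_pmfI) (auto dest: length_source_pmf[OF assms])
  thus ?thesis by simp
qed

text \<open>The pathwise bound holds on the event, of probability at least \<open>1 / 2\<close>,
  that the first block contains half of all chunks of length \<open>l\<close>; off this event the
  length is bounded below by 0.\<close>

lemma expectation_mFLD_short_chunks:
  assumes "A > 0" "B > 0" "L > 0" "l > 0" "2 * 2 ^ l \<le> L div l"
  shows "real ((B - 1) * (L div l) * l) / 2
         \<le> measure_pmf.expectation (source_pmf A B L \<delta>) (\<lambda>s. real (mFLD_length L l s))"
proof -
  let ?M = "source_pmf A B L \<delta>"
  define t where "t = real ((B - 1) * (L div l) * l)"
  define good where "good = {y :: bool list. 2 ^ l \<le> 2 * card (set (chunks_of l y))}"
  have "measure_pmf.prob (pmf_of_set {y :: bool list. length y = L}) good \<ge> 1 / 2"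
    using prob_few_chunks[OF assms(4,5)]
      measure_pmf.prob_compl[of good "pmf_of_set {y :: bool list. length y = L}"]
    by (simp add: good_def Compl_eq_Diff_UNIV[symmetric] Collect_neg_eq[symmetric] not_le)
  hence "t * (1 / 2) \<le> t * measure_pmf.prob ?M (take L -` good)"
    unfolding take_source_pmf[OF assms(1,2), of L \<delta>, symmetric]
    by (intro mult_left_mono) (simp_all add: t_def)
  also have "\<dots> = measure_pmf.expectation ?M (\<lambda>s. t * indicator (take L -` good) s)"
    by simp
  also have "\<dots> \<le> measure_pmf.expectation ?M (\<lambda>s. real (mFLD_length L l s))"
  proof (intro integral_mono_AE integrable_source_pmf assms AE_pmfI)
    fix s assume "s \<in> set_pmf ?M"
    hence "length s = B * L" using length_source_pmf assms by blast
    thus "t * indicator (take L -` good) s \<le> real (mFLD_length L l s)"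
      using mFLD_length_large_first_block[of l L B s] assms
      by (auto simp: indicator_def good_def t_def simp del: of_nat_mult)
  qed
  finally show ?thesis by (simp add: t_def)
qed

text \<open>Linearity of expectation over the full chunks. Since every position is at most
  \<open>B * L\<close>, one bound on the probability of an earlier occurrence serves for all of
  them.\<close>

lemma expectation_mFLD_long_chunks:
  assumes "0 < \<delta>" "\<delta> < 1 / 2" "A > 0" "L > 0" "l > 0"
  shows "real (B * (L div l) * l) * (1 - real B * real L * (1 - \<delta>) ^ l)
         \<le> measure_pmf.expectation (source_pmf A B L \<delta>) (\<lambda>s. real (mFLD_length L l s))"
proof -
  let ?M = "source_pmf A B L \<delta>"
  define E where "E = (\<lambda>q. {s :: bool list. sublist (take l (drop q s)) (take q s)})"
  have prob: "1 - real B * real L * (1 - \<delta>) ^ l \<le> measure_pmf.prob ?M (- E (b * L + i * l))"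
    if "b < B" "i < L div l" for b i
  proof -
    define q where "q = b * L + i * l"
    have "Suc i * l \<le> L div l * l" using that by (intro mult_le_mono1) simp
    also have "\<dots> \<le> L" by simp
    finally have "q + l \<le> Suc b * L" by (simp add: q_def)
    also have "\<dots> \<le> B * L" using that by (intro mult_le_mono1) simp
    finally have q: "q + l \<le> B * L" .
    have "measure_pmf.prob ?M (E q) \<le> real q * (1 - \<delta>) ^ l"
      unfolding E_def by (intro prob_source_sublist_le assms q)
    also have "\<dots> \<le> real (B * L) * (1 - \<delta>) ^ l"
      using q assms by (intro mult_right_mono of_nat_mono) auto
    finally show ?thesis
      using measure_pmf.prob_compl[of "E q" ?M] by (simp add: q_def Compl_eq_Diff_UNIV)
  qed
  have "real (B * (L div l) * l) * (1 - real B * real L * (1 - \<delta>) ^ l)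
      = (\<Sum>b<B. \<Sum>i<L div l. real l * (1 - real B * real L * (1 - \<delta>) ^ l))"
    by (simp add: mult_ac)
  also have "\<dots> \<le> (\<Sum>b<B. \<Sum>i<L div l. real l * measure_pmf.prob ?M (- E (b * L + i * l)))"
    by (intro sum_mono mult_left_mono prob) auto
  also have "\<dots> = measure_pmf.expectation ?M
      (\<lambda>s. \<Sum>b<B. \<Sum>i<L div l. real l * indicator (- E (b * L + i * l)) s)"
    unfolding Bochner_Integration.integral_sum[OF integrable_source_pmf[OF assms(3)]] by simp
  also have "\<dots> \<le> measure_pmf.expectation ?M (\<lambda>s. real (mFLD_length L l s))"
  proof (intro integral_mono_AE integrable_source_pmf assms AE_pmfI)
    fix s assume "s \<in> set_pmf ?M"
    hence "length s = B * L" using length_source_pmf assms by blast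
    from mFLD_length_ge_new_chunks[OF assms(5,4) this]
    have le: "real (\<Sum>b<B. \<Sum>i<L div l. if s \<in> E (b * L + i * l) then 0 else l) \<le> real (mFLD_length L l s)"
      by (intro of_nat_mono) (simp add: E_def)
    have "(\<Sum>b<B. \<Sum>i<L div l. real l * indicator (- E (b * L + i * l)) s)
        = real (\<Sum>b<B. \<Sum>i<L div l. if s \<in> E (b * L + i * l) then 0 else l)"
      unfolding of_nat_sum by (intro sum.cong refl) simp
    with le show "(\<Sum>b<B. \<Sum>i<L div l. real l * indicator (- E (b * L + i * l)) s) \<le> real (mFLD_length L l s)"
      by linarith
  qed
  finally show ?thesis .
qed

lemma mFLD_ratio_le:
  assumes "A > 0" "B > 0" "L > 0"
    and "real B * real L / 8 \<le> measure_pmf.expectation (source_pmf A B L \<delta>) (\<lambda>s. real (mFLD_length L l s))"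
  shows "mFLD_ratio L l (source_pmf A B L \<delta>) \<le> 8"
proof -
  \<comment> \<open>This makes the expected encoding length positive, so the quotient is not a
    division by zero.\<close>
  have "0 < real B * real L" using assms by simp
  thus ?thesis
    using assms(4) unfolding mFLD_ratio_def expectation_length_source[OF assms(1)]
    by (simp add: field_simps)
qed

text \<open>The remainder is less than \<open>l\<close>, and \<open>l\<close> is at most the part
  covered by full chunks because at least one chunk fits.\<close>

lemma half_le_div_mult:
  assumes "l > 0" "l \<le> (L::nat)"
  shows "real L / 2 \<le> real (L div l * l)"
proof -
  have "1 \<le> L div l" using assms by (simp add: Suc_leI div_greater_zero_iff)
  hence "1 * l \<le> L div l * l" by (rule mult_le_mono1)
  moreover have "L = L div l * l + L mod l" by simp
  moreover have "L mod l < l" using assms by simp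
  ultimately have "L \<le> 2 * (L div l * l)" by linarith
  hence "real L \<le> real (2 * (L div l * l))" by (rule of_nat_mono)
  thus ?thesis by simp
qed

lemma mFLD_ratio_short_chunks:
  assumes "A > 0" "B \<ge> 2" "l > 0" "l \<le> L" "2 * 2 ^ l \<le> L div l"
  shows "mFLD_ratio L l (source_pmf A B L \<delta>) \<le> 8"
proof (rule mFLD_ratio_le)
  \<comment> \<open>The three halvings pay for the dropped first block (\<open>B \<ge> 2\<close>),
    for the incomplete chunks, and for the probability of a good first block.\<close>
  have "real B * real L / 8 = (real B / 2 * (real L / 2)) / 2" by simp
  also have "\<dots> \<le> (real (B - 1) * real (L div l * l)) / 2"
    using assms by (intro divide_right_mono mult_mono half_le_div_mult) auto
  also have "\<dots> = real ((B - 1) * (L div l) * l) / 2" by simp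
  also have "\<dots> \<le> measure_pmf.expectation (source_pmf A B L \<delta>) (\<lambda>s. real (mFLD_length L l s))"
    using assms by (intro expectation_mFLD_short_chunks) auto
  finally show "real B * real L / 8 \<le> \<dots>" .
qed (use assms in auto)

lemma mFLD_ratio_long_chunks:
  assumes "0 < \<delta>" "\<delta> < 1 / 2" "A > 0" "B > 0" "l > 0" "l \<le> L"
    and "real B * real L * (1 - \<delta>) ^ l \<le> 1 / 2"
  shows "mFLD_ratio L l (source_pmf A B L \<delta>) \<le> 8"
proof (rule mFLD_ratio_le)
  \<comment> \<open>Here two halvings suffice, for the incomplete chunks and for repeated ones;
    \<open>8\<close> is kept to share one constant between the regimes.\<close>
  have "real B * real L / 8 \<le> (real B * (real L / 2)) * (1 / 2)" by simp
  also have "\<dots> \<le> (real B * real (L div l * l)) * (1 - real B * real L * (1 - \<delta>) ^ l)"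
    using assms by (intro mult_mono half_le_div_mult mult_nonneg_nonneg) auto
  also have "\<dots> = real (B * (L div l) * l) * (1 - real B * real L * (1 - \<delta>) ^ l)" by simp
  also have "\<dots> \<le> measure_pmf.expectation (source_pmf A B L \<delta>) (\<lambda>s. real (mFLD_length L l s))"
    using assms by (intro expectation_mFLD_long_chunks) auto
  finally show "real B * real L / 8 \<le> \<dots>" .
qed (use assms in auto)

section \<open>The two asymptotic regimes\<close>

text \<open>Both \<open>2 ^ l B\<close> and \<open>l B\<close> are eventually at most
  \<open>B powr (k1 / 4)\<close>, so twice their product is of smaller order than
  \<open>B powr k1\<close>, hence than \<open>L B\<close>.\<close>

lemma eventually_short_chunks:
  fixes L l :: "nat \<Rightarrow> nat"
  assumes k1: "0 < k1"
    and L: "(\<lambda>B. real (L B)) \<in> \<Omega>(\<lambda>B. real B powr k1)"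
    and l: "\<forall>\<^sub>F B in sequentially. 1 \<le> l B"
    and small: "(\<lambda>B. real (l B)) \<in> o(\<lambda>B. log 2 (real B))"
  shows "\<forall>\<^sub>F B in sequentially. 2 * 2 ^ l B \<le> L B div l B"
proof -
  obtain C where C: "C > 0" "\<forall>\<^sub>F B in sequentially. C * norm (real B powr k1) \<le> norm (real (L B))"
    using L by (elim landau_omega.bigE)
  have "\<forall>\<^sub>F B in sequentially. norm (real (l B)) \<le> k1 / 4 * norm (log 2 (real B))"
    using small k1 by (intro landau_o.smallD) auto
  \<comment> \<open>The spare factor \<open>B powr (k1 / 2)\<close> absorbs the factor 2 and the
    constant \<open>C\<close>.\<close>
  moreover have "\<forall>\<^sub>F B in sequentially. 2 \<le> C * real B powr (k1 / 2)"
  proof -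
    have "filterlim (\<lambda>B. C * real B powr (k1 / 2)) at_top sequentially"
      using C k1 by real_asymp
    thus ?thesis by (simp add: filterlim_at_top)
  qed
  ultimately show ?thesis
    using C(2) l eventually_gt_at_top[of 0]
  proof eventually_elim
    case (elim B)
    have lB: "real (l B) \<le> k1 / 4 * log 2 (real B)" using elim by simp
    have "(2::real) ^ l B = 2 powr real (l B)" by (simp add: powr_realpow)
    also have "\<dots> \<le> 2 powr (log 2 (real B) * (k1 / 4))" using lB by (simp add: mult.commute)
    also have "\<dots> = real B powr (k1 / 4)"
      using elim by (subst powr_powr[symmetric]) simp
    finally have pow: "2 ^ l B \<le> real B powr (k1 / 4)" .
    have "real (l B) \<le> real B powr (k1 / 4)"
      using of_nat_less_two_power[of "l B", where ?'a = real] pow by linarith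
    hence "real (2 * 2 ^ l B * l B) \<le> 2 * real B powr (k1 / 4) * real B powr (k1 / 4)"
      using pow by (simp, intro mult_mono) auto
    also have "\<dots> = 2 * real B powr (k1 / 2)" by (simp add: powr_add[symmetric])
    also have "\<dots> \<le> (C * real B powr (k1 / 2)) * real B powr (k1 / 2)"
      using elim by (intro mult_right_mono) auto
    also have "\<dots> = C * real B powr k1" by (simp add: powr_add[symmetric] mult.assoc)
    also have "\<dots> \<le> real (L B)" using elim by simp
    finally have "2 * 2 ^ l B * l B \<le> L B" by (simp only: of_nat_le_iff)
    thus ?case using elim by (simp add: less_eq_div_iff_mult_less_eq)
  qed
qed

lemma eventually_long_chunks:
  fixes L l :: "nat \<Rightarrow> nat"
  assumes k1: "0 < k1" and \<delta>: "0 < \<delta>" "\<delta> < 1 / 2"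
    and L: "(\<lambda>B. real (L B)) \<in> O(\<lambda>B. real B powr k1)"
    and large: "(\<lambda>B. real (l B)) \<in> \<omega>(\<lambda>B. log 2 (real B))"
  shows "\<forall>\<^sub>F B in sequentially. real B * real (L B) * (1 - \<delta>) ^ l B \<le> 1 / 2"
proof -
  obtain C where C: "C > 0" "\<forall>\<^sub>F B in sequentially. norm (real (L B)) \<le> C * norm (real B powr k1)"
    using L by (elim landau_o.bigE)
  \<comment> \<open>Chosen such that \<open>(1 - \<delta>) ^ n = 2 powr (- a * n)\<close>.\<close>
  define a where "a = - log 2 (1 - \<delta>)"
  have a: "a > 0" using \<delta> by (simp add: a_def)
  \<comment> \<open>This factor gives \<open>(1 - \<delta>) ^ l B \<le> B powr (- (2 + k1))\<close>.
    Against \<open>B * L B\<close>, which is of order at most \<open>B powr (1 + k1)\<close>, a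
    factor \<open>1 / B\<close> is left to absorb \<open>C\<close>.\<close>
  have "\<forall>\<^sub>F B in sequentially. (2 + k1) / a * norm (log 2 (real B)) \<le> norm (real (l B))"
    using large k1 a by (intro landau_omega.smallD) auto
  moreover have "\<forall>\<^sub>F B in sequentially. 2 * C \<le> real B"
    using filterlim_real_sequentially by (simp add: filterlim_at_top)
  ultimately show ?thesis
    using C(2) eventually_gt_at_top[of 0]
  proof eventually_elim
    case (elim B)
    have "(2 + k1) / a * log 2 (real B) \<le> real (l B)" using elim by simp
    hence lB: "(2 + k1) * log 2 (real B) \<le> a * real (l B)" using a by (simp add: field_simps)
    have "(1 - \<delta>) ^ l B = (2 powr (- a)) powr real (l B)"
      using \<delta> by (simp add: a_def powr_realpow)
    also have "\<dots> = 2 powr (- (a * real (l B)))" by (simp add: powr_powr)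
    also have "\<dots> \<le> 2 powr (log 2 (real B) * (- (2 + k1)))" using lB by (simp add: algebra_simps)
    also have "\<dots> = real B powr (- (2 + k1))"
      using elim by (subst powr_powr[symmetric]) simp
    finally have "real B * real (L B) * (1 - \<delta>) ^ l B
        \<le> real B powr 1 * (C * real B powr k1) * real B powr (- (2 + k1))"
      using elim \<delta> C(1) by (intro mult_mono) auto
    also have "\<dots> = C * (real B powr 1 * real B powr k1 * real B powr (- (2 + k1)))"
      by (simp only: mult_ac)
    also have "\<dots> = C * real B powr (- 1)"
      by (simp only: powr_add[symmetric]) simp
    also have "\<dots> \<le> 1 / 2"
      using elim by (simp add: powr_minus field_simps)
    finally show ?case .
  qed
qed

text \<open>\<open>c\<close> is bound outside all parameters, which makes it universal, whereas the
  threshold on \<open>B\<close> may depend on them. The condition \<open>l B \<le> L B\<close>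
  reflects that the chunk length is at most the first-stage parsing length.\<close>

theorem corollary2:
  shows "\<exists>c::real. \<forall>(k1::real) (k2::real) (\<delta>::real)
           (A :: nat \<Rightarrow> nat) (L :: nat \<Rightarrow> nat) (l :: nat \<Rightarrow> nat).
      0 < k1 \<longrightarrow> 0 < k2 \<longrightarrow> k2 < 1 \<longrightarrow> 0 < \<delta> \<longrightarrow> \<delta> < 1 / 2 \<longrightarrow>
      filterlim A at_top sequentially \<longrightarrow>
      (\<forall>\<^sub>F B in sequentially. real (A B) \<le> real B powr (1 - k2)) \<longrightarrow>
      filterlim L at_top sequentially \<longrightarrow>
      (\<lambda>B. real (L B)) \<in> \<Theta>(\<lambda>B. real B powr k1) \<longrightarrow>
      (\<forall>\<^sub>F B in sequentially. 1 \<le> l B \<and> l B \<le> L B) \<longrightarrow>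
      (\<lambda>B. real (l B)) \<in> o(\<lambda>B. log 2 (real B)) \<or>
      (\<lambda>B. real (l B)) \<in> \<omega>(\<lambda>B. log 2 (real B)) \<longrightarrow>
      (\<forall>\<^sub>F B in sequentially.
         mFLD_ratio (L B) (l B) (source_pmf (A B) B (L B) \<delta>) \<le> c)"
proof (intro exI[of _ 8] allI impI)
  fix k1 k2 \<delta> :: real and A L l :: "nat \<Rightarrow> nat"
  assume k1: "0 < k1" and \<delta>: "0 < \<delta>" "\<delta> < 1 / 2"
    and A: "filterlim A at_top sequentially"
    and L: "(\<lambda>B. real (L B)) \<in> \<Theta>(\<lambda>B. real B powr k1)"
    and l: "\<forall>\<^sub>F B in sequentially. 1 \<le> l B \<and> l B \<le> L B"
    and regime: "(\<lambda>B. real (l B)) \<in> o(\<lambda>B. log 2 (real B)) \<or>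
      (\<lambda>B. real (l B)) \<in> \<omega>(\<lambda>B. log 2 (real B))"
  have A0: "\<forall>\<^sub>F B in sequentially. 1 \<le> A B" using A by (simp add: filterlim_at_top)
  from regime show "\<forall>\<^sub>F B in sequentially. mFLD_ratio (L B) (l B) (source_pmf (A B) B (L B) \<delta>) \<le> 8"
  proof
    assume small: "(\<lambda>B. real (l B)) \<in> o(\<lambda>B. log 2 (real B))"
    have "\<forall>\<^sub>F B in sequentially. 1 \<le> l B" using l by eventually_elim simp
    \<comment> \<open>Short chunks call for the lower bound on \<open>L\<close>, so that one block
      shows enough of them; long chunks call for the upper bound, which limits the number of earlier
      positions.\<close>
    from eventually_short_chunks[OF k1 bigthetaD2[OF L] this small] A0 l eventually_ge_at_top[of 2]
    show ?thesis by eventually_elim (auto intro: mFLD_ratio_short_chunks)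
  next
    assume "(\<lambda>B. real (l B)) \<in> \<omega>(\<lambda>B. log 2 (real B))"
    from eventually_long_chunks[OF k1 \<delta> bigthetaD1[OF L] this] A0 l eventually_gt_at_top[of 0]
    show ?thesis by eventually_elim (auto intro: mFLD_ratio_long_chunks \<delta>)
  qed
qed

end
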